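(* Let $H$ be a complex Hilbert space with $\dim H\geq 2$, let $\mathcal A$ be a von Neumann algebra of operators acting on $H$, and let $\phi:E(\mathcal A)\to E(\mathcal A)$ be either an ortho-order automorphism of $E(\mathcal A)$ or a sequential automorphism of $E(\mathcal A)$. Then $\phi$ preserves the order and zero product in both directions, i.e., for all $A,B\in E(\mathcal A)$, \[ A\leq B\Longleftrightarrow\phi(A)\leq\phi(B)\qquad\text{and}\qquad AB=0\Longleftrightarrow\phi(A)\phi(B)=0. \]
   Context: $E(H)$ denotes the set of all effects on $H$, i.e., all positive bounded linear operators $A$ on $H$ with $0\leq A\leq I$, where $I$ is the identity on $H$ (which belongs to $\mathcal A$), and $E(\mathcal A)=E(H)\cap\mathcal A$ is the set of all effects belonging to $\mathcal A$. The order $\leq$ is the usual order among self-adjoint bounded linear operators, $A'=I-A$, and the sequential product is $A\circ B=\sqrt{A}\,B\sqrt{A}$ for $A,B\in E(\mathcal A)$. An ortho-order automorphism of $E(\mathcal A)$ is a bijective map $\phi:E(\mathcal A)\to E(\mathcal A)$ such that for all $A,B\in E(\mathcal A)$ we have $A\leq B\Longleftrightarrow\phi(A)\leq\phi(B)$ and $\phi(A')=\phi(A)'$. A sequential automorphism of $E(\mathcal A)$ is a bijective map $\phi:E(\mathcal A)\to E(\mathcal A)$ such that $\phi(A\circ B)=\phi(A)\circ\phi(B)$ for all $A,B\in E(\mathcal A)$. *)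

theory Defs
  imports "HOL-Analysis.Analysis"
begin

(* A complex inner product space is built on top of its underlying real inner product space, whose
   inner product is the real part of the complex one; the norm and topology are those of real_inner.
   The complex inner product is linear in the first argument; positive definiteness is
   inherited from real_inner. *)
class complex_inner = real_inner +
  fixes scaleC :: "complex \<Rightarrow> 'a \<Rightarrow> 'a" (infixr "*\<^sub>C" 75)
    and cinner :: "'a \<Rightarrow> 'a \<Rightarrow> complex"
  assumes scaleC_add_right: "c *\<^sub>C (x + y) = c *\<^sub>C x + c *\<^sub>C y"
    and scaleC_add_left: "(c + d) *\<^sub>C x = c *\<^sub>C x + d *\<^sub>C x"
    and scaleC_scaleC: "c *\<^sub>C d *\<^sub>C x = (c * d) *\<^sub>C x"
    and scaleC_of_real: "complex_of_real r *\<^sub>C x = r *\<^sub>R x"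
    and cinner_commute: "cinner x y = cnj (cinner y x)"
    and cinner_add_left: "cinner (x + y) z = cinner x z + cinner y z"
    and cinner_scaleC_left: "cinner (c *\<^sub>C x) y = c * cinner x y"
    and Re_cinner: "Re (cinner x y) = x \<bullet> y"

class complex_hilbert_space = complex_inner + complete_space

lemma vector_space_scaleC: "vector_space (scaleC :: complex \<Rightarrow> 'a \<Rightarrow> 'a::complex_inner)"
proof
  show "1 *\<^sub>C x = x" for x :: 'a
    using scaleC_of_real[of 1 x] by simp
qed (simp_all add: scaleC_add_right scaleC_add_left scaleC_scaleC)

global_interpretation complex_vector: vector_space "scaleC :: complex \<Rightarrow> 'a \<Rightarrow> 'a::complex_inner"
  by (rule vector_space_scaleC)

definition orthonormal_basis :: "'a::complex_hilbert_space set \<Rightarrow> bool" where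
  "orthonormal_basis B \<longleftrightarrow>
     (\<forall>x\<in>B. \<forall>y\<in>B. cinner x y = (if x = y then 1 else 0)) \<and>
     closure (complex_vector.span B) = UNIV"

(* The type of blinfuns consists of the real-linear bounded operators. *)
definition bounded_ops :: "('a::complex_hilbert_space \<Rightarrow>\<^sub>L 'a) set" where
  "bounded_ops = {A :: 'a \<Rightarrow>\<^sub>L 'a. \<forall>c x. A (c *\<^sub>C x) = c *\<^sub>C A x}"

definition adjoint_of :: "('a::complex_hilbert_space \<Rightarrow>\<^sub>L 'a) \<Rightarrow> ('a \<Rightarrow>\<^sub>L 'a) \<Rightarrow> bool" where
  "adjoint_of A B \<longleftrightarrow> (\<forall>x y. cinner (A x) y = cinner x (B y))"

definition commutant :: "('a::complex_hilbert_space \<Rightarrow>\<^sub>L 'a) set \<Rightarrow> ('a \<Rightarrow>\<^sub>L 'a) set" where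
  "commutant M = {T \<in> bounded_ops. \<forall>A\<in>M. T o\<^sub>L A = A o\<^sub>L T}"

(* The bicommutant condition makes M a subalgebra containing the identity. *)
definition von_neumann_algebra :: "('a::complex_hilbert_space \<Rightarrow>\<^sub>L 'a) set \<Rightarrow> bool" where
  "von_neumann_algebra M \<longleftrightarrow>
     M \<subseteq> bounded_ops \<and>
     (\<forall>A\<in>M. \<exists>B\<in>M. adjoint_of A B) \<and>
     commutant (commutant M) = M"

(* On a complex Hilbert space this implies self-adjointness. *)
definition positive_op :: "('a::complex_hilbert_space \<Rightarrow>\<^sub>L 'a) \<Rightarrow> bool" where
  "positive_op A \<longleftrightarrow> A \<in> bounded_ops \<and> (\<forall>x. cinner (A x) x \<in> \<real>\<^sub>\<ge>\<^sub>0)"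

definition op_le :: "('a::complex_hilbert_space \<Rightarrow>\<^sub>L 'a) \<Rightarrow> ('a \<Rightarrow>\<^sub>L 'a) \<Rightarrow> bool"
    (infix "\<preceq>" 50) where
  "A \<preceq> B \<longleftrightarrow> positive_op (B - A)"

definition effects :: "('a::complex_hilbert_space \<Rightarrow>\<^sub>L 'a) set" where
  "effects = {A \<in> bounded_ops. 0 \<preceq> A \<and> A \<preceq> id_blinfun}"

definition effects_in ::
    "('a::complex_hilbert_space \<Rightarrow>\<^sub>L 'a) set \<Rightarrow> ('a \<Rightarrow>\<^sub>L 'a) set" where
  "effects_in M = effects \<inter> M"

definition op_compl :: "('a::complex_hilbert_space \<Rightarrow>\<^sub>L 'a) \<Rightarrow> ('a \<Rightarrow>\<^sub>L 'a)" where
  "op_compl A = id_blinfun - A"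

definition op_sqrt :: "('a::complex_hilbert_space \<Rightarrow>\<^sub>L 'a) \<Rightarrow> ('a \<Rightarrow>\<^sub>L 'a)" where
  "op_sqrt A = (THE S. positive_op S \<and> S o\<^sub>L S = A)"

definition seq_prod ::
    "('a::complex_hilbert_space \<Rightarrow>\<^sub>L 'a) \<Rightarrow> ('a \<Rightarrow>\<^sub>L 'a) \<Rightarrow> ('a \<Rightarrow>\<^sub>L 'a)" where
  "seq_prod A B = op_sqrt A o\<^sub>L B o\<^sub>L op_sqrt A"

definition ortho_order_automorphism ::
    "('a::complex_hilbert_space \<Rightarrow>\<^sub>L 'a) set \<Rightarrow> (('a \<Rightarrow>\<^sub>L 'a) \<Rightarrow> ('a \<Rightarrow>\<^sub>L 'a)) \<Rightarrow> bool" where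
  "ortho_order_automorphism M \<phi> \<longleftrightarrow>
     bij_betw \<phi> (effects_in M) (effects_in M) \<and>
     (\<forall>A\<in>effects_in M. \<forall>B\<in>effects_in M. A \<preceq> B \<longleftrightarrow> \<phi> A \<preceq> \<phi> B) \<and>
     (\<forall>A\<in>effects_in M. \<phi> (op_compl A) = op_compl (\<phi> A))"

definition sequential_automorphism ::
    "('a::complex_hilbert_space \<Rightarrow>\<^sub>L 'a) set \<Rightarrow> (('a \<Rightarrow>\<^sub>L 'a) \<Rightarrow> ('a \<Rightarrow>\<^sub>L 'a)) \<Rightarrow> bool" where
  "sequential_automorphism M \<phi> \<longleftrightarrow>
     bij_betw \<phi> (effects_in M) (effects_in M) \<and>
     (\<forall>A\<in>effects_in M. \<forall>B\<in>effects_in M. \<phi> (seq_prod A B) = seq_prod (\<phi> A) (\<phi> B))"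

end

theory Submission
  imports Defs
begin

text \<open>
  Both kinds of automorphism preserve order and zero product because each of these two relations
  can be defined from the structure that the automorphism respects.

  For ortho-order automorphisms only the zero product is at stake.  Call an effect \<open>P\<close> sharp if
  \<open>0\<close> is the only effect of the algebra below both \<open>P\<close> and \<open>I - P\<close>; the sharp effects are the
  projections (\<open>sharp_iff_idempotent\<close>).  Then \<open>A B = 0\<close> holds iff some sharp \<open>P\<close> satisfies
  \<open>A \<le> P\<close> and \<open>B \<le> I - P\<close>, the witness being the range projection of \<open>A\<close>
  (\<open>zero_product_iff_sharp\<close>).

  For sequential automorphisms, \<open>A \<le> B\<close> holds iff \<open>A = \<surd>B C \<surd>B\<close> for some effect \<open>C\<close> of the
  algebra (\<open>op_le_iff_seq_prod\<close>), so the order is definable from the sequential product.  Hence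
  the least effect \<open>0\<close> is fixed, and the zero product is preserved because \<open>A B = 0\<close> iff the
  sequential product of \<open>A\<close> and \<open>B\<close> is \<open>0\<close> (\<open>seq_prod_eq_0_iff\<close>).

  The range projection and the effect \<open>C\<close> both come from one result, Douglas' factorisation
  of an operator through another one that dominates it, carried out inside the algebra
  (\<open>effect_factorisation\<close>).  It rests on the projection theorem and on the bicommutant
  condition: whatever is constructed canonically from elements of the algebra commutes with the
  commutant and so belongs to the algebra.  The same argument places square roots in the algebra
  (\<open>vN_sqrt\<close>); these are obtained by a norm-convergent iteration.
\<close>

section \<open>Effects in terms of the real inner product\<close>

instance complex_hilbert_space \<subseteq> banach ..

lemma cinner_self: "cinner x x = complex_of_real (x \<bullet> x)"
proof (rule complex_eqI)
  show "Im (cinner x x) = Im (complex_of_real (x \<bullet> x))"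
    using arg_cong[OF cinner_commute[of x x], of Im] by simp
qed (simp add: Re_cinner)

lemma cinner_scaleC_right: "cinner x (c *\<^sub>C y) = cnj c * cinner x y"
proof -
  have "cinner x (c *\<^sub>C y) = cnj (c * cinner y x)"
    using cinner_commute[of x "c *\<^sub>C y"] by (simp add: cinner_scaleC_left)
  then show ?thesis using cinner_commute[of x y] by simp
qed

lemma norm_scaleC: "norm (c *\<^sub>C x :: 'a::complex_inner) = cmod c * norm x"
proof -
  have "(norm (c *\<^sub>C x))\<^sup>2 = Re (cinner (c *\<^sub>C x) (c *\<^sub>C x))"
    by (simp add: Re_cinner power2_norm_eq_inner)
  also have "\<dots> = Re (complex_of_real ((cmod c)\<^sup>2 * (x \<bullet> x)))"
    unfolding cinner_scaleC_left cinner_scaleC_right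
    by (simp only: cinner_self of_real_mult complex_norm_square mult_ac)
  also have "\<dots> = (cmod c * norm x)\<^sup>2"
    by (simp add: power2_norm_eq_inner power_mult_distrib)
  finally show ?thesis by (simp add: power2_eq_iff_nonneg)
qed

lemma bounded_linear_scaleC: "bounded_linear (\<lambda>x :: 'a::complex_inner. c *\<^sub>C x)"
proof (rule bounded_linear_intro[where K = "cmod c"])
  show "c *\<^sub>C (r *\<^sub>R x) = r *\<^sub>R (c *\<^sub>C x)" for r and x :: 'a
    by (simp add: scaleC_of_real[symmetric] scaleC_scaleC mult.commute)
qed (simp_all add: scaleC_add_right norm_scaleC mult.commute)

lemma Im_cinner: "Im (cinner x y) = ((- \<i>) *\<^sub>C x) \<bullet> y"
  unfolding Re_cinner[symmetric] cinner_scaleC_left by simp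

definition self_adjoint :: "('a::complex_hilbert_space \<Rightarrow>\<^sub>L 'a) \<Rightarrow> bool" where
  "self_adjoint A \<longleftrightarrow> (\<forall>x y. A x \<bullet> y = x \<bullet> A y)"

lemma self_adjointD: "self_adjoint A \<Longrightarrow> A x \<bullet> y = x \<bullet> A y"
  by (simp add: self_adjoint_def)

lemma bounded_opsD: "A \<in> bounded_ops \<Longrightarrow> A (c *\<^sub>C x) = c *\<^sub>C A x"
  by (simp add: bounded_ops_def)

lemmas blinfun_pointwise = blinfun.diff_left blinfun.diff_right blinfun.add_left blinfun.add_right
  blinfun.scaleR_left blinfun.scaleR_right blinfun.zero_left blinfun.zero_right id_blinfun.rep_eq

text \<open>Positivity asks the complex numbers \<open>\<langle>A x, x\<rangle>\<close> to be real; polarising the vanishing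
  imaginary part of this quadratic form and replacing \<open>y\<close> by \<open>\<i> y\<close> gives the symmetry.
  From here on only the real inner product occurs.\<close>

lemma positive_op_iff:
  fixes A :: "'a::complex_hilbert_space \<Rightarrow>\<^sub>L 'a"
  shows
  "positive_op A \<longleftrightarrow> A \<in> bounded_ops \<and> self_adjoint A \<and> (\<forall>x. 0 \<le> A x \<bullet> x)"
proof (cases "A \<in> bounded_ops")
  case True
  note lin = bounded_opsD[OF True]
  have Im_eq: "Im (cinner (A x) y) = A ((- \<i>) *\<^sub>C x) \<bullet> y" for x y
    by (simp only: Im_cinner lin)
  have sa_iff: "(\<forall>x. Im (cinner (A x) x) = 0) \<longleftrightarrow> self_adjoint A"
  proof
    assume im: "\<forall>x. Im (cinner (A x) x) = 0"
    show "self_adjoint A"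
      unfolding self_adjoint_def
    proof (intro allI)
      fix x y :: 'a
      let ?z = "\<i> *\<^sub>C y"
      have "Im (cinner (A (x + ?z)) (x + ?z)) = 0" using im by blast
      then have "A ((- \<i>) *\<^sub>C x) \<bullet> x + A ((- \<i>) *\<^sub>C ?z) \<bullet> x
          + A ((- \<i>) *\<^sub>C x) \<bullet> ?z + A ((- \<i>) *\<^sub>C ?z) \<bullet> ?z = 0"
        unfolding Im_eq
        by (simp only: scaleC_add_right blinfun.add_right inner_add_left inner_add_right)
      moreover have "A ((- \<i>) *\<^sub>C x) \<bullet> x = 0" "A ((- \<i>) *\<^sub>C ?z) \<bullet> ?z = 0"
        using im unfolding Im_eq by blast+
      moreover have "(- \<i>) *\<^sub>C ?z = y"
        by (simp add: scaleC_scaleC)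
      moreover have "A ((- \<i>) *\<^sub>C x) \<bullet> ?z = - (A x \<bullet> y)"
        unfolding lin Re_cinner[symmetric] cinner_scaleC_left cinner_scaleC_right by simp
      ultimately show "A x \<bullet> y = x \<bullet> A y"
        by (simp add: inner_commute)
    qed
  next
    assume sa: "self_adjoint A"
    show "\<forall>x. Im (cinner (A x) x) = 0"
    proof
      fix x
      have "Im (cinner (A x) x) = ((- \<i>) *\<^sub>C x) \<bullet> A x"
        unfolding Im_eq using sa by (rule self_adjointD)
      also have "\<dots> = Im (cinner x (A x))"
        by (simp only: Im_cinner)
      also have "\<dots> = - Im (cinner (A x) x)"
        using arg_cong[OF cinner_commute[of x "A x"], of Im] by simp
      finally show "Im (cinner (A x) x) = 0" by simp
    qed
  qed
  have "positive_op A \<longleftrightarrow> (\<forall>x. 0 \<le> A x \<bullet> x) \<and> (\<forall>x. Im (cinner (A x) x) = 0)"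
    using True by (auto simp: positive_op_def complex_nonneg_Reals_iff Re_cinner)
  then show ?thesis using True sa_iff by blast
qed (simp add: positive_op_def)

lemma bounded_ops_diff: "A \<in> bounded_ops \<Longrightarrow> B \<in> bounded_ops \<Longrightarrow> A - B \<in> bounded_ops"
  by (simp add: bounded_ops_def blinfun_pointwise complex_vector.scale_right_diff_distrib)

lemma bounded_ops_id: "id_blinfun \<in> bounded_ops"
  by (simp add: bounded_ops_def blinfun_pointwise)

lemma bounded_ops_0: "0 \<in> bounded_ops"
  by (simp add: bounded_ops_def)

lemma bounded_ops_compose:
  "A \<in> bounded_ops \<Longrightarrow> B \<in> bounded_ops \<Longrightarrow> A o\<^sub>L B \<in> bounded_ops"
  by (simp add: bounded_ops_def)

lemma self_adjoint_diff: "self_adjoint A \<Longrightarrow> self_adjoint B \<Longrightarrow> self_adjoint (A - B)"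
  by (simp add: self_adjoint_def blinfun_pointwise inner_diff_left inner_diff_right)

lemma self_adjoint_id: "self_adjoint id_blinfun"
  by (simp add: self_adjoint_def blinfun_pointwise)

lemma effects_iff:
  "A \<in> effects \<longleftrightarrow>
     A \<in> bounded_ops \<and> self_adjoint A \<and> (\<forall>x. 0 \<le> A x \<bullet> x \<and> A x \<bullet> x \<le> x \<bullet> x)"
proof -
  have "self_adjoint (id_blinfun - A)" if "self_adjoint A"
    using that by (simp add: self_adjoint_diff self_adjoint_id)
  then show ?thesis
    by (auto simp: effects_def op_le_def positive_op_iff bounded_ops_diff bounded_ops_id
        blinfun_pointwise inner_diff_left)
qed

lemma effectD:
  assumes "A \<in> effects"
  shows "A \<in> bounded_ops" "self_adjoint A" "0 \<le> A x \<bullet> x" "A x \<bullet> x \<le> x \<bullet> x"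
  using assms by (auto simp: effects_iff)

lemma effect_inner: "A \<in> effects \<Longrightarrow> A x \<bullet> y = x \<bullet> A y"
  by (simp add: effectD(2) self_adjointD)

lemma op_le_effects_iff:
  assumes "A \<in> effects" "B \<in> effects"
  shows "A \<preceq> B \<longleftrightarrow> (\<forall>x. A x \<bullet> x \<le> B x \<bullet> x)"
  using assms
  by (auto simp: op_le_def positive_op_iff effects_iff bounded_ops_diff self_adjoint_diff
      blinfun_pointwise inner_diff_left)

lemma op_compl_effects: "A \<in> effects \<Longrightarrow> op_compl A \<in> effects"
  by (auto simp: effects_iff op_compl_def bounded_ops_diff bounded_ops_id self_adjoint_diff
      self_adjoint_id blinfun_pointwise inner_diff_left)

lemma zero_effect: "0 \<in> effects"
  by (simp add: effects_iff bounded_ops_0 self_adjoint_def)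

text \<open>This is \<open>A\<^sup>2 \<le> A\<close>: indeed \<open>A - A\<^sup>2\<close> is the sum of the two positive operators
  \<open>(I - A) A (I - A)\<close> and \<open>A (I - A) A\<close>.\<close>

lemma effect_square_le:
  assumes "A \<in> effects"
  shows "A x \<bullet> A x \<le> A x \<bullet> x"
proof -
  have "0 \<le> A (x - A x) \<bullet> (x - A x)" "A (A x) \<bullet> A x \<le> A x \<bullet> A x"
    using assms by (simp_all only: effectD)
  moreover have "A (x - A x) \<bullet> (x - A x) = A x \<bullet> x - 2 * (A x \<bullet> A x) + A (A x) \<bullet> A x"
    using effect_inner[OF assms, of "A x" x]
    by (simp add: blinfun_pointwise inner_diff_left inner_diff_right)
  ultimately show ?thesis by simp
qed

lemma effect_norm_le:
  assumes "A \<in> effects"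
  shows "norm (A x) \<le> norm x"
  using effect_square_le[OF assms, of x] effectD(4)[OF assms, of x] by (simp add: norm_le)

lemma effect_eq_0I:
  assumes "A \<in> effects" "A x \<bullet> x \<le> 0"
  shows "A x = 0"
proof -
  have "A x \<bullet> A x \<le> 0"
    using effect_square_le[OF assms(1), of x] assms(2) by simp
  then show ?thesis
    by (metis inner_eq_zero_iff inner_ge_zero order_antisym)
qed

lemma op_le_zero_imp_zero:
  fixes A :: "'a::complex_hilbert_space \<Rightarrow>\<^sub>L 'a"
  assumes "A \<in> effects" "A \<preceq> 0"
  shows "A = 0"
proof (rule blinfun_eqI)
  show "A x = blinfun_apply 0 x" for x
    using assms effect_eq_0I[of A x] by (simp add: op_le_effects_iff zero_effect)
qed

lemma blinfun_eq_innerI: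
  fixes A B :: "'a::real_inner \<Rightarrow>\<^sub>L 'a"
  assumes "\<And>x y. A x \<bullet> y = B x \<bullet> y"
  shows "A = B"
proof (rule blinfun_eqI)
  fix x
  have "(A x - B x) \<bullet> (A x - B x) = 0"
    using assms[of x "A x - B x"] by (simp add: inner_diff_left)
  then show "A x = B x" by simp
qed

section \<open>Square roots\<close>

text \<open>The limit \<open>Y\<close> of the iteration satisfies \<open>2 Y = X + Y\<^sup>2\<close>, that is \<open>(I - Y)\<^sup>2 = I - X\<close>.  The
  same iteration for the number 1 in place of \<open>X\<close> majorises norms and increments; it is
  increasing and bounded, so the operators converge in norm.\<close>

fun root_iter :: "('a::complex_hilbert_space \<Rightarrow>\<^sub>L 'a) \<Rightarrow> nat \<Rightarrow> 'a \<Rightarrow>\<^sub>L 'a" where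
  "root_iter X 0 = 0"
| "root_iter X (Suc n) = (1/2) *\<^sub>R (X + (root_iter X n o\<^sub>L root_iter X n))"

fun root_bound :: "nat \<Rightarrow> real" where
  "root_bound 0 = 0"
| "root_bound (Suc n) = (1 + (root_bound n)\<^sup>2) / 2"

lemma root_bound_range: "0 \<le> root_bound n" "root_bound n \<le> 1"
proof -
  have "0 \<le> root_bound n \<and> root_bound n \<le> 1"
    by (induction n) (auto simp: power_le_one)
  then show "0 \<le> root_bound n" "root_bound n \<le> 1" by auto
qed

lemma root_bound_mono: "root_bound n \<le> root_bound (Suc n)"
proof -
  have "0 \<le> (1 - root_bound n)\<^sup>2" by simp
  then show ?thesis by (simp add: power2_eq_square algebra_simps)
qed

lemma root_iter_commute:
  fixes X :: "'a::complex_hilbert_space \<Rightarrow>\<^sub>L 'a"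
  assumes T: "bounded_linear T" and comm: "\<And>x. X (T x) = T (X x)"
  shows "root_iter X n (T x) = T (root_iter X n x)"
proof (induction n arbitrary: x)
  case 0
  show ?case using linear_0[OF bounded_linear.linear[OF T]] by simp
next
  case (Suc n)
  show ?case
    using Suc comm
    by (simp add: blinfun_pointwise linear_add[OF bounded_linear.linear[OF T]]
        linear_scale[OF bounded_linear.linear[OF T]])
qed

lemma root_iter_norm:
  assumes "norm X \<le> 1"
  shows "norm (root_iter X n) \<le> root_bound n"
proof (induction n)
  case (Suc n)
  have "norm (X + (root_iter X n o\<^sub>L root_iter X n))
      \<le> norm X + norm (root_iter X n) * norm (root_iter X n)"
    by (rule order_trans[OF norm_triangle_ineq add_left_mono[OF norm_blinfun_compose]])
  also have "\<dots> \<le> 1 + (root_bound n)\<^sup>2"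
    using Suc assms by (auto simp: power2_eq_square intro!: add_mono mult_mono root_bound_range)
  finally show ?case by simp
qed simp

lemma root_iter_step:
  assumes "norm X \<le> 1"
  shows "norm (root_iter X (Suc n) - root_iter X n) \<le> root_bound (Suc n) - root_bound n"
proof (induction n)
  case 0
  show ?case using assms by simp
next
  case (Suc n)
  let ?Y = "root_iter X n" and ?Z = "root_iter X (Suc n)"
  have X_comm: "?Y (X x) = X (?Y x)" for x
    by (rule root_iter_commute) (simp_all add: blinfun.bounded_linear_right)
  have comm: "?Y (?Z x) = ?Z (?Y x)" for x
    using root_iter_commute[OF blinfun.bounded_linear_right, of X ?Y "Suc n" x] X_comm
    by (simp del: root_iter.simps)
  have "root_iter X (Suc (Suc n)) - ?Z = (1/2) *\<^sub>R ((?Z - ?Y) o\<^sub>L (?Z + ?Y))"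
    by (rule blinfun_eqI, subst root_iter.simps(2)[of X "Suc n"],
        subst (3) root_iter.simps(2), simp only: blinfun_pointwise blinfun_apply_blinfun_compose comm)
      (simp add: algebra_simps)
  then have "norm (root_iter X (Suc (Suc n)) - ?Z) \<le> (1/2) * (norm (?Z - ?Y) * norm (?Z + ?Y))"
    by (simp del: root_iter.simps add: norm_blinfun_compose)
  also have "\<dots> \<le> (1/2) * ((root_bound (Suc n) - root_bound n) * (root_bound (Suc n) + root_bound n))"
    using Suc root_iter_norm[OF assms] root_bound_mono[of n]
    by (intro mult_left_mono mult_mono norm_triangle_mono) (auto simp del: root_iter.simps root_bound.simps)
  also have "\<dots> = root_bound (Suc (Suc n)) - root_bound (Suc n)"
    by (subst root_bound.simps(2)[of "Suc n"], subst (3) root_bound.simps(2))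
      (simp add: power2_eq_square field_simps del: root_bound.simps)
  finally show ?case .
qed

lemma root_iter_convergent:
  assumes "norm X \<le> 1"
  shows "convergent (root_iter X)"
proof -
  have "incseq root_bound"
    using root_bound_mono by (rule incseq_SucI)
  then obtain c where "root_bound \<longlonglongrightarrow> c"
    using root_bound_range by (metis incseq_convergent)
  then have "summable (\<lambda>n. root_bound (Suc n) - root_bound n)"
    by (rule telescope_summable)
  then have "summable (\<lambda>n. root_iter X (Suc n) - root_iter X n)"
    by (rule summable_comparison_test'[where N = 0]) (rule root_iter_step[OF assms])
  then have "convergent (\<lambda>n. \<Sum>k<n. root_iter X (Suc k) - root_iter X k)"
    by (simp only: summable_iff_convergent)
  then show ?thesis
    by (simp add: sum_lessThan_telescope del: root_iter.simps(2))
qed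

lemma positive_sqrt_effect:
  assumes A: "A \<in> effects" and S: "positive_op S" "S o\<^sub>L S = A"
  shows "S \<in> effects"
proof -
  have S': "S \<in> bounded_ops" "self_adjoint S" "0 \<le> S x \<bullet> x" for x
    using S(1) by (simp_all add: positive_op_iff)
  have "S x \<bullet> x \<le> x \<bullet> x" for x
  proof -
    have "S x \<bullet> S x = A x \<bullet> x"
      using self_adjointD[OF S'(2), of "S x" x] S(2) by auto
    then have "norm (S x) \<le> norm x"
      using effectD(4)[OF A, of x] by (simp add: norm_le)
    have "S x \<bullet> x \<le> norm (S x) * norm x" by (rule norm_cauchy_schwarz)
    also have "\<dots> \<le> norm x * norm x"
      using \<open>norm (S x) \<le> norm x\<close> by (simp add: mult_right_mono)
    finally show ?thesis by (simp add: norm_eq_sqrt_inner)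
  qed
  then show ?thesis using S' by (simp add: effects_iff)
qed

text \<open>Commutation is stated for arbitrary bounded real-linear maps \<open>T\<close>: the choice of
  multiplication by a complex number shows that the root is complex linear, and the choice of an
  operator in the commutant shows that it lies in the von Neumann algebra.\<close>

lemma effect_sqrt_exists:
  assumes A: "A \<in> effects"
  obtains S where "S \<in> effects" "S o\<^sub>L S = A"
    "\<And>T x. bounded_linear T \<Longrightarrow> (\<And>x. A (T x) = T (A x)) \<Longrightarrow> S (T x) = T (S x)"
proof -
  define X where "X = op_compl A"
  have X: "X \<in> effects"
    unfolding X_def using A by (rule op_compl_effects)
  have "norm X \<le> 1"
    using effect_norm_le[OF X] by (intro norm_blinfun_bound) auto
  then obtain Y where Y: "root_iter X \<longlonglongrightarrow> Y"
    using root_iter_convergent unfolding convergent_def by blast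
  have Y_apply: "(\<lambda>n. root_iter X n x) \<longlonglongrightarrow> Y x" for x
    by (intro blinfun.tendsto Y tendsto_const)
  have "norm Y \<le> 1"
    using root_iter_norm[OF \<open>norm X \<le> 1\<close>] root_bound_range
    by (intro LIMSEQ_le_const2[OF tendsto_norm[OF Y]]) (meson order_trans)
  then have Y_norm: "norm (Y x) \<le> norm x" for x
    by (metis norm_blinfun mult_right_mono norm_ge_zero mult_1 order_trans)
  have Y_comm: "Y (T x) = T (Y x)" if T: "bounded_linear T" and "\<And>x. X (T x) = T (X x)" for T x
    using LIMSEQ_unique[OF Y_apply[of "T x"]] bounded_linear.tendsto[OF T Y_apply[of x]]
    by (simp add: root_iter_commute[OF that])
  have "(\<lambda>n. root_iter X (Suc n)) \<longlonglongrightarrow> (1/2) *\<^sub>R (X + (Y o\<^sub>L Y))"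
    unfolding root_iter.simps
    by (intro tendsto_intros bounded_bilinear.tendsto[OF bounded_bilinear_blinfun_compose] Y)
  then have Y_fix: "Y = (1/2) *\<^sub>R (X + (Y o\<^sub>L Y))"
    using LIMSEQ_Suc[OF Y] LIMSEQ_unique by blast
  have iter_sa: "root_iter X n x \<bullet> y = x \<bullet> root_iter X n y" for n x y
    by (induction n arbitrary: x y)
      (simp_all add: blinfun_pointwise inner_add_left inner_add_right effect_inner[OF X])
  have "Y x \<bullet> y = x \<bullet> Y y" for x y
  proof (rule LIMSEQ_unique)
    show "(\<lambda>n. root_iter X n x \<bullet> y) \<longlonglongrightarrow> Y x \<bullet> y"
      by (intro tendsto_intros Y_apply)
    show "(\<lambda>n. root_iter X n x \<bullet> y) \<longlonglongrightarrow> x \<bullet> Y y"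
      unfolding iter_sa by (intro tendsto_intros Y_apply)
  qed
  then have Y_sa: "self_adjoint Y" by (simp add: self_adjoint_def)
  have "X (c *\<^sub>C x) = c *\<^sub>C X x" for c x
    using X by (simp add: effectD(1) bounded_opsD)
  then have Y_lin: "Y \<in> bounded_ops"
    using Y_comm[OF bounded_linear_scaleC] by (simp add: bounded_ops_def)
  define S where "S = id_blinfun - Y"
  have S_sq: "S o\<^sub>L S = A"
  proof (rule blinfun_eqI)
    fix x
    have "2 *\<^sub>R Y x = X x + Y (Y x)"
      by (subst Y_fix) (simp add: blinfun_pointwise)
    then have "X x = 2 *\<^sub>R Y x - Y (Y x)" by simp
    moreover have "A x = x - X x"
      by (simp add: X_def op_compl_def blinfun_pointwise)
    ultimately show "(S o\<^sub>L S) x = A x"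
      by (simp add: S_def blinfun_pointwise scaleR_2)
  qed
  have S_sa: "self_adjoint S" and S_lin: "S \<in> bounded_ops"
    by (simp_all add: S_def self_adjoint_diff self_adjoint_id Y_sa bounded_ops_diff bounded_ops_id Y_lin)
  have S_pos: "0 \<le> S x \<bullet> x" for x
  proof -
    have "Y x \<bullet> x \<le> norm (Y x) * norm x" by (rule norm_cauchy_schwarz)
    also have "\<dots> \<le> norm x * norm x" using Y_norm by (simp add: mult_right_mono)
    finally show ?thesis
      by (simp add: S_def blinfun_pointwise inner_diff_left norm_eq_sqrt_inner)
  qed
  have "S \<in> effects"
    by (rule positive_sqrt_effect[OF A]) (simp_all add: positive_op_iff S_sa S_lin S_pos S_sq)
  moreover have "S (T x) = T (S x)" if T: "bounded_linear T" and "\<And>x. A (T x) = T (A x)" for T x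
  proof -
    have diff: "T (x - y) = T x - T y" for x y
      using linear_diff[OF bounded_linear.linear[OF T]] .
    have "Y (T x) = T (Y x)"
      using T by (rule Y_comm) (simp add: X_def op_compl_def blinfun_pointwise that diff)
    then show ?thesis by (simp add: S_def blinfun_pointwise diff)
  qed
  ultimately show ?thesis using S_sq that by blast
qed

text \<open>For commuting \<open>S\<close> and \<open>T\<close> with the same square, \<open>(S + T) (S - T) = 0\<close>.  Testing this
  against \<open>S - T\<close> gives a sum of two nonnegative numbers, so both \<open>S\<close> and \<open>T\<close> vanish on the
  range of \<open>S - T\<close>.\<close>

lemma op_sqrt_unique:
  assumes A: "A \<in> effects" and S: "positive_op S" "S o\<^sub>L S = A"
    and T: "positive_op T" "T o\<^sub>L T = A"
    and comm: "\<And>x. S (T x) = T (S x)"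
  shows "S = T"
proof (rule blinfun_eqI)
  fix x
  have S': "S \<in> effects" and T': "T \<in> effects"
    using positive_sqrt_effect A S T by blast+
  define D where "D = S - T"
  have D_sa: "D u \<bullet> v = u \<bullet> D v" for u v
    by (simp add: D_def blinfun_pointwise inner_diff_left inner_diff_right effect_inner S' T')
  have sq: "S (S u) = T (T u)" for u
    using S(2) T(2) by (metis blinfun_apply_blinfun_compose)
  have "S (D x) + T (D x) = 0"
    by (simp add: D_def blinfun_pointwise comm sq)
  then have "S (D x) \<bullet> D x + T (D x) \<bullet> D x = 0"
    by (simp add: inner_add_left[symmetric])
  then have "S (D x) \<bullet> D x = 0" "T (D x) \<bullet> D x = 0"
    using effectD(3)[OF S', of "D x"] effectD(3)[OF T', of "D x"] by linarith+
  then have "S (D x) = 0" "T (D x) = 0"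
    using S' T' by (simp_all add: effect_eq_0I)
  then have "D (D x) = 0" by (simp add: D_def blinfun_pointwise)
  then have "D x \<bullet> D x = 0" by (simp add: D_sa)
  then show "S x = T x" by (simp add: D_def blinfun_pointwise)
qed

lemma op_sqrt_effect:
  assumes A: "A \<in> effects"
  shows "op_sqrt A \<in> effects" "op_sqrt A o\<^sub>L op_sqrt A = A"
    "\<And>T x. bounded_linear T \<Longrightarrow> (\<And>x. A (T x) = T (A x)) \<Longrightarrow> op_sqrt A (T x) = T (op_sqrt A x)"
proof -
  obtain S where S: "S \<in> effects" "S o\<^sub>L S = A"
    and comm: "\<And>T x. bounded_linear T \<Longrightarrow> (\<And>x. A (T x) = T (A x)) \<Longrightarrow> S (T x) = T (S x)"
    using effect_sqrt_exists[OF A] by blast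
  have pos: "positive_op S"
    using S(1) by (simp add: positive_op_iff effects_iff)
  have "op_sqrt A = S"
    unfolding op_sqrt_def
  proof (rule the_equality)
    fix T :: "'a \<Rightarrow>\<^sub>L 'a"
    assume T: "positive_op T \<and> T o\<^sub>L T = A"
    \<comment> \<open>Any root \<open>T\<close> commutes with \<open>A = T\<^sup>2\<close>, hence with \<open>S\<close>.\<close>
    have "S (T x) = T (S x)" for x
      using T by (intro comm blinfun.bounded_linear_right) auto
    then show "T = S"
      using op_sqrt_unique[OF A pos S(2), of T] T by simp
  qed (simp add: pos S(2))
  then show "op_sqrt A \<in> effects" "op_sqrt A o\<^sub>L op_sqrt A = A"
    "\<And>T x. bounded_linear T \<Longrightarrow> (\<And>x. A (T x) = T (A x)) \<Longrightarrow> op_sqrt A (T x) = T (op_sqrt A x)"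
    using S comm by simp_all
qed

lemma op_sqrt_sqrt: "A \<in> effects \<Longrightarrow> op_sqrt A (op_sqrt A x) = A x"
  by (metis blinfun_apply_blinfun_compose op_sqrt_effect(2))

section \<open>Operators in a von Neumann algebra\<close>

lemma vN_commute:
  assumes "A \<in> M" "T \<in> commutant M"
  shows "A (T x) = T (A x)"
  using assms unfolding commutant_def by (metis (mono_tags, lifting) blinfun_apply_blinfun_compose mem_Collect_eq)

lemma vN_memI:
  assumes "von_neumann_algebra M" "X \<in> bounded_ops"
    and "\<And>T x. T \<in> commutant M \<Longrightarrow> X (T x) = T (X x)"
  shows "X \<in> M"
proof -
  have "X \<in> commutant (commutant M)"
    using assms(2,3) by (auto simp: commutant_def[of "commutant M"] intro!: blinfun_eqI)
  then show ?thesis using assms(1) by (simp add: von_neumann_algebra_def)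
qed

lemma vN_bounded_ops: "von_neumann_algebra M \<Longrightarrow> A \<in> M \<Longrightarrow> A \<in> bounded_ops"
  by (auto simp: von_neumann_algebra_def)

lemma vN_compose:
  assumes "von_neumann_algebra M" "A \<in> M" "B \<in> M"
  shows "A o\<^sub>L B \<in> M"
  using assms(1) by (rule vN_memI)
    (use assms in \<open>simp_all add: bounded_ops_compose vN_bounded_ops vN_commute\<close>)

lemma vN_diff:
  assumes "von_neumann_algebra M" "A \<in> M" "B \<in> M"
  shows "A - B \<in> M"
  using assms(1) by (rule vN_memI)
    (use assms in \<open>simp_all add: bounded_ops_diff vN_bounded_ops vN_commute blinfun_pointwise\<close>)

lemma vN_0: "von_neumann_algebra M \<Longrightarrow> 0 \<in> M"
  by (rule vN_memI) (simp_all add: bounded_ops_0)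

lemma vN_id: "von_neumann_algebra M \<Longrightarrow> id_blinfun \<in> M"
  by (rule vN_memI) (simp_all add: bounded_ops_id)

lemma vN_sqrt:
  assumes "von_neumann_algebra M" "A \<in> effects" "A \<in> M"
  shows "op_sqrt A \<in> M"
  using assms(1)
proof (rule vN_memI)
  show "op_sqrt A \<in> bounded_ops"
    using assms by (simp add: op_sqrt_effect effectD(1))
  show "op_sqrt A (T x) = T (op_sqrt A x)" if "T \<in> commutant M" for T x
    by (rule op_sqrt_effect(3))
      (simp_all add: assms blinfun.bounded_linear_right vN_commute[OF _ that])
qed

lemma effects_in_op_compl:
  "von_neumann_algebra M \<Longrightarrow> A \<in> effects_in M \<Longrightarrow> op_compl A \<in> effects_in M"
  by (simp add: effects_in_def op_compl_effects) (simp add: op_compl_def vN_diff vN_id)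

lemma effects_in_sqrt:
  "von_neumann_algebra M \<Longrightarrow> A \<in> effects_in M \<Longrightarrow> op_sqrt A \<in> effects_in M"
  by (simp add: effects_in_def op_sqrt_effect(1) vN_sqrt)

lemma effects_in_0: "von_neumann_algebra M \<Longrightarrow> 0 \<in> effects_in M"
  by (simp add: effects_in_def zero_effect vN_0)

section \<open>Factorisation of dominated operators\<close>

text \<open>The Hilbert projection theorem for a subspace: a minimising sequence is Cauchy by the
  parallelogram law, and its limit cannot be improved in any direction of the subspace.\<close>

lemma orthogonal_projection_exists:
  fixes V :: "'a::{real_inner, complete_space} set"
  assumes V: "subspace V"
  obtains p where "p \<in> closure V" "\<And>v. v \<in> V \<Longrightarrow> (w - p) \<bullet> v = 0"
proof -
  define d where "d = (INF v\<in>V. (norm (w - v))\<^sup>2)"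
  have d_le: "d \<le> (norm (w - v))\<^sup>2" if "v \<in> V" for v
    unfolding d_def by (rule cINF_lower[OF _ that]) (rule bdd_belowI2[where m = 0], simp)
  have "\<exists>v\<in>V. (norm (w - v))\<^sup>2 < d + inverse (real (Suc n))" for n
  proof -
    have "V \<noteq> {}" using subspace_0[OF V] by blast
    moreover have "d < d + inverse (real (Suc n))" by simp
    moreover have "bdd_below ((\<lambda>v. (norm (w - v))\<^sup>2) ` V)"
      by (rule bdd_belowI2[where m = 0]) simp
    ultimately show ?thesis
      unfolding d_def by (subst (asm) cINF_less_iff) auto
  qed
  then obtain v where v: "\<And>n. v n \<in> V" "\<And>n. (norm (w - v n))\<^sup>2 < d + inverse (real (Suc n))"
    by metis
  have close: "(norm (v n - v m))\<^sup>2 \<le> 2 * inverse (real (Suc n)) + 2 * inverse (real (Suc m))" for n m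
  proof -
    have "(1/2) *\<^sub>R (v n + v m) \<in> V"
      using V v(1) by (simp add: subspace_add subspace_scale)
    then have "d \<le> (norm (w - (1/2) *\<^sub>R (v n + v m)))\<^sup>2" by (rule d_le)
    moreover have "(norm (v n - v m))\<^sup>2 + 4 * (norm (w - (1/2) *\<^sub>R (v n + v m)))\<^sup>2
        = 2 * (norm (w - v n))\<^sup>2 + 2 * (norm (w - v m))\<^sup>2"
      unfolding power2_norm_eq_inner
      by (simp add: inner_diff_left inner_diff_right inner_add_left inner_add_right
          inner_commute algebra_simps)
    ultimately show ?thesis using v(2)[of n] v(2)[of m] by linarith
  qed
  have "Cauchy v"
  proof (rule metric_CauchyI)
    fix e :: real assume "0 < e"
    then obtain N where N: "inverse (real (Suc N)) < e\<^sup>2 / 4"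
      using reals_Archimedean[of "e\<^sup>2 / 4"] by auto
    have "dist (v m) (v n) < e" if "m \<ge> N" "n \<ge> N" for m n
    proof -
      have "inverse (real (Suc m)) \<le> inverse (real (Suc N))" "inverse (real (Suc n)) \<le> inverse (real (Suc N))"
        using that by (auto intro!: le_imp_inverse_le)
      then have "(norm (v m - v n))\<^sup>2 < e\<^sup>2"
        using close[of m n] N by linarith
      then show ?thesis
        using \<open>0 < e\<close> by (simp add: dist_norm power2_less_imp_less)
    qed
    then show "\<exists>N. \<forall>m\<ge>N. \<forall>n\<ge>N. dist (v m) (v n) < e" by blast
  qed
  then obtain p where p: "v \<longlonglongrightarrow> p"
    using Cauchy_convergent convergent_def by blast
  have "p \<in> closure V"
    using p v(1) closure_sequential by blast
  have p_le: "(norm (w - p))\<^sup>2 \<le> d"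
  proof (rule LIMSEQ_le)
    show "(\<lambda>n. (norm (w - v n))\<^sup>2) \<longlonglongrightarrow> (norm (w - p))\<^sup>2"
      by (intro tendsto_intros p)
    show "(\<lambda>n. d + inverse (real (Suc n))) \<longlonglongrightarrow> d"
      using tendsto_add[OF tendsto_const LIMSEQ_inverse_real_of_nat] by simp
    show "\<exists>N. \<forall>n\<ge>N. (norm (w - v n))\<^sup>2 \<le> d + inverse (real (Suc n))"
      using v(2) less_imp_le by blast
  qed
  have p_min: "d \<le> (norm (w - p - u))\<^sup>2" if "u \<in> V" for u
  proof (rule LIMSEQ_le_const)
    show "(\<lambda>n. (norm (w - v n - u))\<^sup>2) \<longlonglongrightarrow> (norm (w - p - u))\<^sup>2"
      by (intro tendsto_intros p)
    have "d \<le> (norm (w - v n - u))\<^sup>2" for n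
      using d_le[of "v n + u"] V v(1) that by (simp add: subspace_add diff_diff_eq)
    then show "\<exists>N. \<forall>n\<ge>N. d \<le> (norm (w - v n - u))\<^sup>2" by blast
  qed
  have "(w - p) \<bullet> u = 0" if "u \<in> V" for u
  proof (cases "u = 0")
    case False
    define t where "t = ((w - p) \<bullet> u) / (u \<bullet> u)"
    have "(norm (w - p))\<^sup>2 \<le> (norm (w - p - t *\<^sub>R u))\<^sup>2"
      using order_trans[OF p_le p_min[of "t *\<^sub>R u"]] V that by (simp only: subspace_scale)
    also have "\<dots> = (norm (w - p))\<^sup>2 - 2 * t * ((w - p) \<bullet> u) + t * (t * (u \<bullet> u))"
      unfolding power2_norm_eq_inner inner_diff_left[of "w - p"] inner_diff_right[of _ "w - p"]
      by (simp add: inner_commute algebra_simps)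
    also have "t * (u \<bullet> u) = (w - p) \<bullet> u"
      using False by (simp add: t_def)
    finally have "t * ((w - p) \<bullet> u) \<le> 0" by simp
    then have "((w - p) \<bullet> u)\<^sup>2 / (u \<bullet> u) \<le> 0"
      by (simp add: t_def power2_eq_square)
    moreover have "0 < u \<bullet> u" using False by simp
    ultimately show ?thesis
      by (simp add: divide_le_0_iff)
  qed simp
  with \<open>p \<in> closure V\<close> show ?thesis using that by blast
qed

lemma closure_range_sequential:
  fixes f :: "'a \<Rightarrow> 'b::metric_space"
  shows "p \<in> closure (range f) \<longleftrightarrow> (\<exists>x. (\<lambda>n. f (x n)) \<longlonglongrightarrow> p)"
proof
  assume "p \<in> closure (range f)"
  then obtain y where y: "\<And>n. y n \<in> range f" "y \<longlonglongrightarrow> p"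
    unfolding closure_sequential by blast
  then obtain x where "\<And>n. y n = f (x n)"
    unfolding image_iff by metis
  then have "y = (\<lambda>n. f (x n))" by (rule ext)
  with y(2) show "\<exists>x. (\<lambda>n. f (x n)) \<longlonglongrightarrow> p" by blast
next
  assume "\<exists>x. (\<lambda>n. f (x n)) \<longlonglongrightarrow> p"
  then obtain x where "(\<lambda>n. f (x n)) \<longlonglongrightarrow> p" ..
  then show "p \<in> closure (range f)"
    unfolding closure_sequential by (intro exI[of _ "\<lambda>n. f (x n)"]) simp
qed

text \<open>This is Douglas' factorisation theorem.  Since \<open>R\<close> is dominated by \<open>S\<close>, the assignment
  \<open>S x \<mapsto> R x\<close> is a well-defined contraction on the range of \<open>S\<close>; it extends to the closure of
  the range, and is continued by zero on the orthogonal complement, which is the kernel of \<open>S\<close>.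
  Both the closure of the range and the kernel of \<open>S\<close> are invariant under every operator that
  commutes with \<open>S\<close> and \<open>R\<close>, so such operators also commute with the extension.\<close>

lemma douglas_factorisation:
  fixes S R :: "'a::complex_hilbert_space \<Rightarrow>\<^sub>L 'a"
  assumes S: "self_adjoint S" and dom: "\<And>x. norm (R x) \<le> norm (S x)"
  obtains D :: "'a \<Rightarrow>\<^sub>L 'a" where "\<And>x. D (S x) = R x" "\<And>x. S x = 0 \<Longrightarrow> D x = 0"
    "\<And>x. norm (D x) \<le> norm x"
    "\<forall>T. bounded_linear T \<and> (\<forall>x. S (T x) = T (S x)) \<and> (\<forall>x. R (T x) = T (R x)) \<longrightarrow>
      (\<forall>x. D (T x) = T (D x))"
proof -
  define K where "K = closure (range (\<lambda>x. (S x, R x)))"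
  have K_seq: "(u, z) \<in> K \<longleftrightarrow> (\<exists>x. (\<lambda>n. (S (x n), R (x n))) \<longlonglongrightarrow> (u, z))" for u z
    unfolding K_def by (rule closure_range_sequential)
  have graph: "(S x, R x) \<in> K" for x
    unfolding K_def by (rule subsetD[OF closure_subset]) simp
  have K_norm: "norm z \<le> norm u" if "(u, z) \<in> K" for u z
  proof -
    have "K \<subseteq> {q. norm (snd q) \<le> norm (fst q)}"
      unfolding K_def using dom
      by (intro closure_minimal closed_Collect_le continuous_intros) auto
    then show ?thesis using that by auto
  qed
  have K_orth: "u \<bullet> v = 0" if "(u, z) \<in> K" "S v = 0" for u v z
  proof -
    have "K \<subseteq> {q. fst q \<bullet> v = 0}"
      unfolding K_def using self_adjointD[OF S] that(2)
      by (intro closure_minimal closed_Collect_eq continuous_intros) auto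
    then show ?thesis using that by auto
  qed
  have K_add: "(u + u', z + z') \<in> K" if uz: "(u, z) \<in> K" and uz': "(u', z') \<in> K" for u z u' z'
  proof -
    obtain x where x: "(\<lambda>n. (S (x n), R (x n))) \<longlonglongrightarrow> (u, z)"
      using uz unfolding K_seq by blast
    obtain x' where x': "(\<lambda>n. (S (x' n), R (x' n))) \<longlonglongrightarrow> (u', z')"
      using uz' unfolding K_seq by blast
    have "(\<lambda>n. (S (x n + x' n), R (x n + x' n))) \<longlonglongrightarrow> (u + u', z + z')"
      using tendsto_add[OF x x'] by (simp add: blinfun_pointwise)
    then show ?thesis
      unfolding K_seq by (rule exI[of _ "\<lambda>n. x n + x' n"])
  qed
  have K_map: "(T u, T z) \<in> K"
    if T: "bounded_linear T" and S_T: "\<And>x. S (T x) = T (S x)" and R_T: "\<And>x. R (T x) = T (R x)"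
      and uz: "(u, z) \<in> K" for T u z
  proof -
    obtain x where x: "(\<lambda>n. (S (x n), R (x n))) \<longlonglongrightarrow> (u, z)"
      using uz unfolding K_seq by blast
    have "(\<lambda>n. (T (S (x n)), T (R (x n)))) \<longlonglongrightarrow> (T u, T z)"
      using tendsto_fst[OF x] tendsto_snd[OF x]
      by (intro tendsto_Pair bounded_linear.tendsto[OF T]) simp_all
    then have "(\<lambda>n. (S (T (x n)), R (T (x n)))) \<longlonglongrightarrow> (T u, T z)"
      by (simp add: S_T R_T)
    then show ?thesis
      unfolding K_seq by (rule exI[of _ "\<lambda>n. T (x n)"])
  qed

  \<comment> \<open>\<open>K\<close> is the graph of the extension to the closed range; \<open>Q\<close> composes it with the orthogonal
    projection \<open>w \<mapsto> u\<close> onto that closure.\<close>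
  define Q where "Q w z \<longleftrightarrow> (\<exists>u. (u, z) \<in> K \<and> S (w - u) = 0)" for w z
  have Q_ex: "\<exists>z. Q w z" for w
  proof -
    have "subspace (range S)"
      using blinfun.bounded_linear_right[of S]
      by (simp add: linear_subspace_image bounded_linear.linear)
    then obtain u where u: "u \<in> closure (range S)" "\<And>y. y \<in> range S \<Longrightarrow> (w - u) \<bullet> y = 0"
      using orthogonal_projection_exists by metis
    have "S (w - u) \<bullet> S (w - u) = 0"
      using u(2) self_adjointD[OF S] by simp
    then have "S (w - u) = 0" by simp
    obtain x where x: "(\<lambda>n. S (x n)) \<longlonglongrightarrow> u"
      using u(1) unfolding closure_range_sequential by blast
    have "Cauchy (\<lambda>n. R (x n))"
    proof (rule metric_CauchyI)
      fix e :: real assume "0 < e"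
      then obtain N where "\<forall>m\<ge>N. \<forall>n\<ge>N. dist (S (x m)) (S (x n)) < e"
        using LIMSEQ_imp_Cauchy[OF x] metric_CauchyD by blast
      moreover have "dist (R (x m)) (R (x n)) \<le> dist (S (x m)) (S (x n))" for m n
        using dom[of "x m - x n"] by (simp add: dist_norm blinfun_pointwise)
      ultimately show "\<exists>N. \<forall>m\<ge>N. \<forall>n\<ge>N. dist (R (x m)) (R (x n)) < e"
        using le_less_trans by blast
    qed
    then obtain z where "(\<lambda>n. R (x n)) \<longlonglongrightarrow> z"
      using Cauchy_convergent convergent_def by blast
    with x have "(\<lambda>n. (S (x n), R (x n))) \<longlonglongrightarrow> (u, z)"
      by (rule tendsto_Pair)
    then have "(u, z) \<in> K"
      unfolding K_seq by (rule exI[of _ x])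
    with \<open>S (w - u) = 0\<close> show ?thesis by (auto simp: Q_def)
  qed
  have Q_norm: "norm z \<le> norm w" if "Q w z" for w z
  proof -
    obtain u where u: "(u, z) \<in> K" "S (w - u) = 0" using \<open>Q w z\<close> by (auto simp: Q_def)
    have "w \<bullet> w = u \<bullet> u + (w - u) \<bullet> (w - u)"
      using K_orth[OF u] by (simp add: inner_diff_left inner_diff_right inner_commute)
    then have "u \<bullet> u \<le> w \<bullet> w" by simp
    then have "norm u \<le> norm w" by (simp add: norm_le)
    then show ?thesis using K_norm[OF u(1)] by simp
  qed
  have Q_add: "Q (w + w') (z + z')" if "Q w z" "Q w' z'" for w z w' z'
  proof -
    obtain u u' where "(u, z) \<in> K" "S (w - u) = 0" "(u', z') \<in> K" "S (w' - u') = 0"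
      using \<open>Q w z\<close> \<open>Q w' z'\<close> by (auto simp: Q_def)
    then have "(u + u', z + z') \<in> K" "S (w + w' - (u + u')) = 0"
      using K_add by (simp_all add: blinfun_pointwise)
    then show ?thesis by (auto simp: Q_def)
  qed
  have Q_map: "Q (T w) (T z)"
    if T: "bounded_linear T" and S_T: "\<And>x. S (T x) = T (S x)" and R_T: "\<And>x. R (T x) = T (R x)"
      and "Q w z" for T w z
  proof -
    obtain u where u: "(u, z) \<in> K" "S (w - u) = 0" using \<open>Q w z\<close> by (auto simp: Q_def)
    have "S (T w - T u) = T (S (w - u))"
      by (simp add: S_T[symmetric] linear_diff[OF bounded_linear.linear[OF T]])
    also have "\<dots> = 0"
      using u(2) linear_0[OF bounded_linear.linear[OF T]] by simp
    finally show ?thesis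
      using K_map[OF T S_T R_T u(1)] by (auto simp: Q_def)
  qed
  have Q_scale: "Q (r *\<^sub>R w) (r *\<^sub>R z)" if "Q w z" for r w z
    by (rule Q_map[OF bounded_linear_scaleR_right _ _ that]) (simp_all add: blinfun_pointwise)
  have Q_unique: "z = z'" if "Q w z" "Q w z'" for w z z'
    using Q_norm[OF Q_add[OF that(1) Q_scale[OF that(2), of "-1"]]] by simp
  define f where "f w = (THE z. Q w z)" for w
  have Q_f: "Q w (f w)" for w
    unfolding f_def using Q_ex Q_unique by (metis theI)
  have f_eqI: "f w = z" if "Q w z" for w z
    using Q_unique[OF Q_f that] .
  have "bounded_linear f"
  proof (rule bounded_linear_intro[where K = 1])
    show "f (x + y) = f x + f y" for x y by (rule f_eqI, rule Q_add[OF Q_f Q_f])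
    show "f (r *\<^sub>R x) = r *\<^sub>R f x" for r x by (rule f_eqI, rule Q_scale[OF Q_f])
    show "norm (f x) \<le> norm x * 1" for x using Q_norm[OF Q_f] by simp
  qed
  then have Blinfun_f: "Blinfun f w = f w" for w by (simp add: bounded_linear_Blinfun_apply)
  have zero: "(0, 0) \<in> K" using graph[of 0] by simp
  show ?thesis
  proof (rule that[of "Blinfun f"], unfold Blinfun_f)
    show "f (S x) = R x" for x
      using graph[of x] by (intro f_eqI) (auto simp: Q_def intro!: exI[of _ "S x"])
    show "f x = 0" if "S x = 0" for x
      using zero that by (intro f_eqI) (auto simp: Q_def intro!: exI[of _ 0])
    show "norm (f x) \<le> norm x" for x by (rule Q_norm[OF Q_f])
    show "\<forall>T. bounded_linear T \<and> (\<forall>x. S (T x) = T (S x)) \<and> (\<forall>x. R (T x) = T (R x)) \<longrightarrow>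
        (\<forall>x. f (T x) = T (f x))"
    proof (intro allI impI)
      fix T :: "'a \<Rightarrow> 'a" and x
      assume T: "bounded_linear T \<and> (\<forall>x. S (T x) = T (S x)) \<and> (\<forall>x. R (T x) = T (R x))"
      show "f (T x) = T (f x)"
        by (rule f_eqI, rule Q_map[OF _ _ _ Q_f]) (simp_all add: T)
    qed
  qed
qed

text \<open>With the contraction \<open>D\<close> of the previous lemma, \<open>D S = R\<close>, the effect is \<open>C = D\<^sup>* D\<close>.  It lies
  in \<open>M\<close> because \<open>D\<close> commutes with the commutant of \<open>M\<close>, and because the bicommutant \<open>M\<close> is closed
  under adjoints.\<close>

lemma effect_factorisation:
  fixes M :: "('a::complex_hilbert_space \<Rightarrow>\<^sub>L 'a) set"
  assumes M: "von_neumann_algebra M" and S: "S \<in> effects_in M" and R: "R \<in> effects_in M"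
    and dom: "\<And>x. norm (R x) \<le> norm (S x)"
  obtains C where "C \<in> effects_in M" "S o\<^sub>L C o\<^sub>L S = R o\<^sub>L R" "\<And>x. S x = 0 \<Longrightarrow> C x = 0"
proof -
  have S': "S \<in> effects" "S \<in> M" and R': "R \<in> effects" "R \<in> M"
    using S R by (auto simp: effects_in_def)
  obtain D :: "'a \<Rightarrow>\<^sub>L 'a" where D: "\<And>x. D (S x) = R x" "\<And>x. S x = 0 \<Longrightarrow> D x = 0" "\<And>x. norm (D x) \<le> norm x"
    and D_all: "\<forall>T. bounded_linear T \<and> (\<forall>x. S (T x) = T (S x)) \<and> (\<forall>x. R (T x) = T (R x)) \<longrightarrow>
      (\<forall>x. D (T x) = T (D x))"
    by (rule douglas_factorisation[OF effectD(2)[OF S'(1)] dom]) (rule that)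
  have D_comm: "D (T x) = T (D x)"
    if "bounded_linear T" "\<And>x. S (T x) = T (S x)" "\<And>x. R (T x) = T (R x)" for T x
    by (rule D_all[rule_format]) (simp add: that)
  have "D (c *\<^sub>C x) = c *\<^sub>C D x" for c x
    by (rule D_comm[OF bounded_linear_scaleC bounded_opsD[OF effectD(1)[OF S'(1)]]
          bounded_opsD[OF effectD(1)[OF R'(1)]]])
  then have "D \<in> bounded_ops" by (simp add: bounded_ops_def)
  with M have "D \<in> M"
  proof (rule vN_memI)
    show "D (T x) = T (D x)" if "T \<in> commutant M" for T x
      by (rule D_comm[OF blinfun.bounded_linear_right vN_commute[OF S'(2) that]
            vN_commute[OF R'(2) that]])
  qed
  then obtain E where "E \<in> M" and E: "adjoint_of D E"
    using M by (auto simp: von_neumann_algebra_def)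
  have E_adj: "E x \<bullet> y = x \<bullet> D y" for x y
    using E by (metis Re_cinner adjoint_of_def inner_commute)
  define C where "C = E o\<^sub>L D"
  have C_inner: "C x \<bullet> y = D x \<bullet> D y" for x y
    by (simp add: C_def E_adj)
  have "C \<in> M"
    unfolding C_def using M \<open>E \<in> M\<close> \<open>D \<in> M\<close> by (rule vN_compose)
  moreover have "C \<in> effects"
    unfolding effects_iff
  proof (intro conjI allI)
    show "C \<in> bounded_ops" using M \<open>C \<in> M\<close> by (rule vN_bounded_ops)
    show "self_adjoint C"
      unfolding self_adjoint_def by (metis C_inner inner_commute)
    show "0 \<le> C x \<bullet> x" for x by (simp add: C_inner)
    show "C x \<bullet> x \<le> x \<bullet> x" for x
      using D(3)[of x] by (simp add: C_inner norm_le)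
  qed
  ultimately have "C \<in> effects_in M" by (simp add: effects_in_def)
  moreover have "S o\<^sub>L C o\<^sub>L S = R o\<^sub>L R"
  proof (rule blinfun_eq_innerI)
    show "(S o\<^sub>L C o\<^sub>L S) x \<bullet> y = (R o\<^sub>L R) x \<bullet> y" for x y
      by (simp add: effect_inner[OF S'(1), of "C (S x)"] effect_inner[OF R'(1), of "R x"] C_inner D(1))
  qed
  moreover have "C x = 0" if "S x = 0" for x
    using D(2)[OF that] by (simp add: C_def)
  ultimately show ?thesis using that by blast
qed

lemma seq_prod_inner:
  assumes "B \<in> effects"
  shows "seq_prod B C x \<bullet> y = C (op_sqrt B x) \<bullet> op_sqrt B y"
  using effect_inner[OF op_sqrt_effect(1)[OF assms]] by (simp add: seq_prod_def)

lemma sqrt_inner: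
  assumes "B \<in> effects"
  shows "op_sqrt B x \<bullet> op_sqrt B y = B x \<bullet> y"
  using effect_inner[OF op_sqrt_effect(1)[OF assms], of "op_sqrt B x" y] op_sqrt_sqrt[OF assms, of x]
  by simp

lemma seq_prod_in:
  assumes M: "von_neumann_algebra M" and B: "B \<in> effects_in M" and C: "C \<in> effects_in M"
  shows "seq_prod B C \<in> effects_in M" "seq_prod B C \<preceq> B"
proof -
  have B': "B \<in> effects" and C': "C \<in> effects"
    using B C by (auto simp: effects_in_def)
  have in_M: "seq_prod B C \<in> M"
    using effects_in_sqrt[OF M B] C by (simp add: seq_prod_def effects_in_def vN_compose M)
  have le: "seq_prod B C x \<bullet> x \<le> B x \<bullet> x" for x
    using effectD(4)[OF C', of "op_sqrt B x"] by (simp add: seq_prod_inner B' sqrt_inner)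
  have "self_adjoint (seq_prod B C)"
    unfolding self_adjoint_def
  proof (intro allI)
    show "seq_prod B C x \<bullet> y = x \<bullet> seq_prod B C y" for x y
      unfolding inner_commute[of x] seq_prod_inner[OF B'] effect_inner[OF C', of "op_sqrt B x"]
      by (rule inner_commute)
  qed
  moreover have "0 \<le> seq_prod B C x \<bullet> x" for x
    using effectD(3)[OF C'] by (simp add: seq_prod_inner B')
  ultimately have eff: "seq_prod B C \<in> effects"
    using vN_bounded_ops[OF M in_M] order_trans[OF le effectD(4)[OF B']]
    by (simp add: effects_iff)
  then show "seq_prod B C \<in> effects_in M"
    using in_M by (simp add: effects_in_def)
  show "seq_prod B C \<preceq> B"
    using le by (simp add: op_le_effects_iff eff B')
qed

text \<open>If \<open>A \<le> B\<close> then \<open>\<parallel>\<surd>A x\<parallel>\<^sup>2 = \<langle>A x, x\<rangle> \<le> \<langle>B x, x\<rangle> = \<parallel>\<surd>B x\<parallel>\<^sup>2\<close>, so the factorisation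
  yields an effect \<open>C\<close> of the algebra with \<open>A = \<surd>B C \<surd>B\<close>.  The converse comes from \<open>C \<le> I\<close>.\<close>

lemma op_le_iff_seq_prod:
  assumes M: "von_neumann_algebra M" and A: "A \<in> effects_in M" and B: "B \<in> effects_in M"
  shows "A \<preceq> B \<longleftrightarrow> (\<exists>C\<in>effects_in M. A = seq_prod B C)"
proof
  assume le: "A \<preceq> B"
  have A': "A \<in> effects" and B': "B \<in> effects"
    using A B by (auto simp: effects_in_def)
  have "norm (op_sqrt A x) \<le> norm (op_sqrt B x)" for x
    using le by (simp add: norm_le sqrt_inner A' B' op_le_effects_iff)
  then obtain C where "C \<in> effects_in M" "op_sqrt B o\<^sub>L C o\<^sub>L op_sqrt B = op_sqrt A o\<^sub>L op_sqrt A"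
    using effect_factorisation[OF M effects_in_sqrt[OF M B] effects_in_sqrt[OF M A]] by blast
  then show "\<exists>C\<in>effects_in M. A = seq_prod B C"
    using op_sqrt_effect(2)[OF A'] by (auto simp: seq_prod_def)
next
  assume "\<exists>C\<in>effects_in M. A = seq_prod B C"
  then show "A \<preceq> B" using seq_prod_in(2)[OF M B] by blast
qed

section \<open>Zero products\<close>

text \<open>If \<open>\<surd>A B \<surd>A = 0\<close> then \<open>\<langle>B u, u\<rangle> = 0\<close> for every \<open>u\<close> in the range of \<open>\<surd>A\<close>, and hence
  \<open>B \<surd>A = 0\<close>; taking adjoints gives \<open>\<surd>A B = 0\<close>.\<close>

lemma seq_prod_eq_0_iff:
  assumes A: "A \<in> effects" and B: "B \<in> effects"
  shows "seq_prod A B = 0 \<longleftrightarrow> A o\<^sub>L B = 0"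
proof
  let ?S = "op_sqrt A"
  note S = op_sqrt_effect(1)[OF A]
  show "A o\<^sub>L B = 0" if "seq_prod A B = 0"
  proof (rule blinfun_eq_innerI)
    fix x y
    have "B (?S (?S y)) = 0"
      using seq_prod_inner[OF A, of B "?S y" "?S y"] that by (intro effect_eq_0I[OF B]) simp
    then have "x \<bullet> B (A y) = 0"
      by (simp add: op_sqrt_sqrt[OF A])
    then show "(A o\<^sub>L B) x \<bullet> y = blinfun_apply 0 x \<bullet> y"
      by (simp add: effect_inner[OF A] effect_inner[OF B])
  qed
  show "seq_prod A B = 0" if "A o\<^sub>L B = 0"
  proof (rule blinfun_eq_innerI)
    fix x y
    have "A (B (?S x)) = 0"
      using that by (metis blinfun_apply_blinfun_compose blinfun.zero_left)
    then have "?S (B (?S x)) \<bullet> ?S (B (?S x)) = 0"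
      by (simp add: sqrt_inner[OF A])
    then show "seq_prod A B x \<bullet> y = blinfun_apply 0 x \<bullet> y"
      by (simp add: seq_prod_def)
  qed
qed

definition sharp :: "('a::complex_hilbert_space \<Rightarrow>\<^sub>L 'a) set \<Rightarrow> ('a \<Rightarrow>\<^sub>L 'a) \<Rightarrow> bool" where
  "sharp M P \<longleftrightarrow> (\<forall>C\<in>effects_in M. C \<preceq> P \<longrightarrow> C \<preceq> op_compl P \<longrightarrow> C = 0)"

lemma op_le_vanish:
  assumes "A \<in> effects" "P \<in> effects" "A \<preceq> P" "P x = 0"
  shows "A x = 0"
  using assms by (intro effect_eq_0I) (auto simp: op_le_effects_iff dest: spec[of _ x])

text \<open>If \<open>P\<close> is sharp then \<open>P (I - P) = 0\<close>, because \<open>P (I - P)\<close> is an effect below both \<open>P\<close> and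
  \<open>I - P\<close>: the differences are \<open>P\<^sup>2\<close> and \<open>(I - P)\<^sup>2\<close>.  Conversely, an effect below an idempotent
  \<open>P\<close> and below \<open>I - P\<close> vanishes on the kernels of both, hence everywhere.\<close>

lemma sharp_iff_idempotent:
  assumes M: "von_neumann_algebra M" and P: "P \<in> effects_in M"
  shows "sharp M P \<longleftrightarrow> (\<forall>x. P (P x) = P x)"
proof
  have P': "P \<in> effects" "P \<in> M" using P by (auto simp: effects_in_def)
  note P_inner = effect_inner[OF P'(1)]
  have Pc: "op_compl P \<in> effects" using P'(1) by (rule op_compl_effects)
  show "\<forall>x. P (P x) = P x" if sharp: "sharp M P"
  proof
    fix x
    define C where "C = P o\<^sub>L op_compl P"
    have C_eq: "C x = P x - P (P x)" for x
      by (simp add: C_def op_compl_def blinfun_pointwise)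
    have "C \<in> M"
      using effects_in_op_compl[OF M P] by (simp add: C_def vN_compose M P' effects_in_def)
    have C_quad: "C x \<bullet> x = P x \<bullet> x - P x \<bullet> P x" for x
      using P_inner[of "P x" x] by (simp add: C_eq inner_diff_left)
    have "C x \<bullet> x \<le> x \<bullet> x" for x
      using effectD(4)[OF P'(1), of x] inner_ge_zero[of "P x"] unfolding C_quad by linarith
    moreover have "self_adjoint C"
      by (simp add: self_adjoint_def C_eq inner_diff_left inner_diff_right P_inner)
    ultimately have C: "C \<in> effects"
      using effect_square_le[OF P'(1)] vN_bounded_ops[OF M \<open>C \<in> M\<close>]
      by (simp add: effects_iff C_quad)
    have "C \<preceq> P"
      by (simp add: op_le_effects_iff C P' C_quad)
    moreover have "C \<preceq> op_compl P"
    proof -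
      have "C x \<bullet> x \<le> op_compl P x \<bullet> x" for x
      proof -
        have "0 \<le> (x - P x) \<bullet> (x - P x)" by simp
        also have "(x - P x) \<bullet> (x - P x) = op_compl P x \<bullet> x - C x \<bullet> x"
          using inner_commute[of x "P x"] unfolding C_quad
          by (simp add: op_compl_def blinfun_pointwise inner_diff_left inner_diff_right)
        finally show ?thesis by simp
      qed
      then show ?thesis by (simp add: op_le_effects_iff C Pc)
    qed
    ultimately have "C = 0"
      using sharp C \<open>C \<in> M\<close> unfolding sharp_def effects_in_def by blast
    then show "P (P x) = P x" using C_eq[of x] by simp
  qed
  show "sharp M P" if idem: "\<forall>x. P (P x) = P x"
    unfolding sharp_def
  proof (intro ballI impI)
    fix C assume C: "C \<in> effects_in M" "C \<preceq> P" "C \<preceq> op_compl P"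
    then have C': "C \<in> effects" by (simp add: effects_in_def)
    show "C = 0"
    proof (rule blinfun_eqI)
      fix x
      have "C (x - P x) = 0"
        using idem by (intro op_le_vanish[OF C' P'(1) C(2)]) (simp add: blinfun_pointwise)
      moreover have "C (P x) = 0"
        using idem by (intro op_le_vanish[OF C' Pc C(3)]) (simp add: op_compl_def blinfun_pointwise)
      ultimately show "C x = blinfun_apply 0 x"
        by (simp add: blinfun_pointwise)
    qed
  qed
qed

text \<open>Factoring \<open>A\<close> through itself, \<open>A P A = A A\<close>, stays inside the algebra and produces the
  projection \<open>P\<close> onto the closure of the range of \<open>A\<close>: the positive form of \<open>I - P\<close> vanishes on
  that range, whence \<open>P A = A = A P\<close>, and then \<open>x - P x\<close> lies in the kernel of \<open>A\<close>.\<close>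

lemma range_projection:
  assumes M: "von_neumann_algebra M" and A: "A \<in> effects_in M"
  obtains P where "P \<in> effects_in M" "sharp M P" "\<And>x. P (A x) = A x" "\<And>x. A x = 0 \<Longrightarrow> P x = 0"
proof -
  have A': "A \<in> effects" using A by (simp add: effects_in_def)
  obtain P where P: "P \<in> effects_in M" "A o\<^sub>L P o\<^sub>L A = A o\<^sub>L A" and ker: "\<And>x. A x = 0 \<Longrightarrow> P x = 0"
    using effect_factorisation[OF M A A] by blast
  have P': "P \<in> effects" using P(1) by (simp add: effects_in_def)
  have APA: "A (P (A x)) = A (A x)" for x
    using P(2) by (metis blinfun_apply_blinfun_compose)
  have PA: "P (A x) = A x" for x
  proof -
    have "op_compl P (A x) \<bullet> A x = A (A x) \<bullet> x - A (P (A x)) \<bullet> x"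
      by (simp add: op_compl_def blinfun_pointwise inner_diff_left effect_inner[OF A'])
    then have "op_compl P (A x) = 0"
      by (intro effect_eq_0I op_compl_effects P') (simp add: APA)
    then show ?thesis by (simp add: op_compl_def blinfun_pointwise)
  qed
  have AP: "A (P x) = A x" for x
  proof -
    have "(A o\<^sub>L P) u \<bullet> v = A u \<bullet> v" for u v
      by (simp add: effect_inner[OF A'] effect_inner[OF P'] PA)
    then have "A o\<^sub>L P = A" by (rule blinfun_eq_innerI)
    then show ?thesis by (metis blinfun_apply_blinfun_compose)
  qed
  have "P (x - P x) = 0" for x
    by (rule ker) (simp add: blinfun_pointwise AP)
  then have "sharp M P"
    by (simp add: sharp_iff_idempotent M P(1) blinfun_pointwise)
  then show ?thesis using that P(1) PA ker by blast
qed

lemma op_le_projectionI: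
  assumes A: "A \<in> effects" and P: "P \<in> effects" and PA: "\<And>x. P (A x) = A x"
    and idem: "\<And>x. P (P x) = P x"
  shows "A \<preceq> P"
proof -
  have "A x \<bullet> x \<le> P x \<bullet> x" for x
  proof -
    have AP: "A (P x) \<bullet> y = A x \<bullet> y" for y
      by (simp add: effect_inner[OF A] effect_inner[OF P] PA)
    have "A x \<bullet> x = A (P x) \<bullet> P x"
      using effect_inner[OF P, of "A x" x] by (simp add: AP PA)
    also have "\<dots> \<le> P x \<bullet> P x" using A by (rule effectD)
    also have "\<dots> = P x \<bullet> x"
      using effect_inner[OF P, of "P x" x] by (simp add: idem)
    finally show ?thesis .
  qed
  then show ?thesis by (simp add: op_le_effects_iff A P)
qed

text \<open>The range projection of \<open>A\<close> separates \<open>A\<close> from \<open>B\<close> if \<open>A B = 0\<close>.  As sharpness is itself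
  defined by the order and the complement, the right-hand side is preserved by every
  ortho-order automorphism.\<close>

lemma zero_product_iff_sharp:
  assumes M: "von_neumann_algebra M" and A: "A \<in> effects_in M" and B: "B \<in> effects_in M"
  shows "A o\<^sub>L B = 0 \<longleftrightarrow> (\<exists>P\<in>effects_in M. sharp M P \<and> A \<preceq> P \<and> B \<preceq> op_compl P)"
proof
  have A': "A \<in> effects" and B': "B \<in> effects" using A B by (auto simp: effects_in_def)
  {
    assume "A o\<^sub>L B = 0"
    then have AB: "A (B x) = 0" for x
      by (metis blinfun_apply_blinfun_compose blinfun.zero_left)
    obtain P where P: "P \<in> effects_in M" "sharp M P" "\<And>x. P (A x) = A x" "\<And>x. A x = 0 \<Longrightarrow> P x = 0"
      using range_projection[OF M A] by blast
    have P': "P \<in> effects" using P(1) by (simp add: effects_in_def)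
    have idem: "P (P x) = P x" for x using P(1,2) sharp_iff_idempotent[OF M] by blast
    have "A \<preceq> P"
      using A' P' P(3) idem by (rule op_le_projectionI)
    moreover have "B \<preceq> op_compl P"
      by (rule op_le_projectionI[OF B' op_compl_effects[OF P']])
        (simp_all add: op_compl_def blinfun_pointwise idem P(4) AB)
    ultimately show "\<exists>P\<in>effects_in M. sharp M P \<and> A \<preceq> P \<and> B \<preceq> op_compl P"
      using P(1,2) by blast
  next
    assume "\<exists>P\<in>effects_in M. sharp M P \<and> A \<preceq> P \<and> B \<preceq> op_compl P"
    then obtain P where P: "P \<in> effects_in M" "sharp M P" "A \<preceq> P" "B \<preceq> op_compl P" by blast
    have P': "P \<in> effects" using P(1) by (simp add: effects_in_def)
    have idem: "P (P x) = P x" for x using P(1,2) sharp_iff_idempotent[OF M] by blast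
    have BP: "B (P x) = 0" for x
      by (rule op_le_vanish[OF B' op_compl_effects[OF P'] P(4)])
        (simp add: op_compl_def blinfun_pointwise idem)
    have A_P: "A (y - P y) = 0" for y
      by (rule op_le_vanish[OF A' P' P(3)]) (simp add: blinfun_pointwise idem)
    show "A o\<^sub>L B = 0"
    proof (rule blinfun_eq_innerI)
      fix x y
      have "A (B x) \<bullet> y = A (P (B x)) \<bullet> y"
        using A_P[of "B x"] by (simp add: blinfun_pointwise)
      also have "\<dots> = x \<bullet> B (P (A y))"
        by (simp add: effect_inner[OF A'] effect_inner[OF P'] effect_inner[OF B'])
      finally show "(A o\<^sub>L B) x \<bullet> y = blinfun_apply 0 x \<bullet> y" by (simp add: BP)
    qed
  }
qed

section \<open>Automorphisms\<close>

lemma bij_betw_zero_if_least: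
  assumes M: "von_neumann_algebra M" and bij: "bij_betw \<phi> (effects_in M) (effects_in M)"
    and mono: "\<And>A B. A \<in> effects_in M \<Longrightarrow> B \<in> effects_in M \<Longrightarrow> A \<preceq> B \<Longrightarrow> \<phi> A \<preceq> \<phi> B"
  shows "\<phi> 0 = 0"
proof -
  have in_M: "\<phi> A \<in> effects_in M" if "A \<in> effects_in M" for A
    using bij that by (auto simp: bij_betw_def)
  obtain B where B: "B \<in> effects_in M" "\<phi> B = 0"
    using bij effects_in_0[OF M] by (metis bij_betw_def imageE)
  have "0 \<preceq> B"
    using B(1) by (simp add: op_le_effects_iff zero_effect effects_in_def effectD(3))
  then have "\<phi> 0 \<preceq> 0"
    using mono[OF effects_in_0[OF M] B(1)] B(2) by simp
  then show ?thesis
    using in_M[OF effects_in_0[OF M]] by (intro op_le_zero_imp_zero) (auto simp: effects_in_def)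
qed

lemma ortho_order_automorphism_zero_product:
  assumes M: "von_neumann_algebra M" and \<phi>: "ortho_order_automorphism M \<phi>"
    and A: "A \<in> effects_in M" and B: "B \<in> effects_in M"
  shows "A o\<^sub>L B = 0 \<longleftrightarrow> \<phi> A o\<^sub>L \<phi> B = 0"
proof -
  let ?E = "effects_in M"
  have bij: "bij_betw \<phi> ?E ?E"
    and le: "\<And>A B. A \<in> ?E \<Longrightarrow> B \<in> ?E \<Longrightarrow> \<phi> A \<preceq> \<phi> B \<longleftrightarrow> A \<preceq> B"
    and compl: "\<And>A. A \<in> ?E \<Longrightarrow> op_compl (\<phi> A) = \<phi> (op_compl A)"
    using \<phi> by (auto simp: ortho_order_automorphism_def)
  have E_eq: "?E = \<phi> ` ?E" using bij by (simp add: bij_betw_def)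
  have in_E: "\<phi> A \<in> ?E" if "A \<in> ?E" for A using E_eq that by blast
  have \<phi>0: "\<phi> 0 = 0" using M bij by (rule bij_betw_zero_if_least) (simp add: le)
  have eq_0: "\<phi> C = 0 \<longleftrightarrow> C = 0" if "C \<in> ?E" for C
    using bij \<phi>0 that effects_in_0[OF M] unfolding bij_betw_def by (metis inj_onD)
  have sharp: "sharp M (\<phi> P) \<longleftrightarrow> sharp M P" if P: "P \<in> ?E" for P
  proof -
    have "sharp M (\<phi> P) \<longleftrightarrow> (\<forall>C\<in>\<phi> ` ?E. C \<preceq> \<phi> P \<longrightarrow> C \<preceq> op_compl (\<phi> P) \<longrightarrow> C = 0)"
      unfolding sharp_def using E_eq by simp
    also have "\<dots> \<longleftrightarrow> sharp M P"
      by (auto simp: sharp_def compl P le eq_0 effects_in_op_compl[OF M])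
    finally show ?thesis .
  qed
  have "\<phi> A o\<^sub>L \<phi> B = 0 \<longleftrightarrow> (\<exists>P\<in>?E. sharp M P \<and> \<phi> A \<preceq> P \<and> \<phi> B \<preceq> op_compl P)"
    using M in_E A B by (intro zero_product_iff_sharp) auto
  also have "\<dots> \<longleftrightarrow> (\<exists>P\<in>\<phi> ` ?E. sharp M P \<and> \<phi> A \<preceq> P \<and> \<phi> B \<preceq> op_compl P)"
    using E_eq by simp
  also have "\<dots> \<longleftrightarrow> (\<exists>P\<in>?E. sharp M P \<and> A \<preceq> P \<and> B \<preceq> op_compl P)"
    by (auto simp: compl le A B sharp effects_in_op_compl[OF M])
  also have "\<dots> \<longleftrightarrow> A o\<^sub>L B = 0"
    using zero_product_iff_sharp[OF M A B] by simp
  finally show ?thesis by simp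
qed

lemma sequential_automorphism_order:
  assumes M: "von_neumann_algebra M" and \<phi>: "sequential_automorphism M \<phi>"
    and A: "A \<in> effects_in M" and B: "B \<in> effects_in M"
  shows "A \<preceq> B \<longleftrightarrow> \<phi> A \<preceq> \<phi> B"
proof -
  let ?E = "effects_in M"
  have bij: "bij_betw \<phi> ?E ?E"
    and seq: "\<And>A B. A \<in> ?E \<Longrightarrow> B \<in> ?E \<Longrightarrow> seq_prod (\<phi> A) (\<phi> B) = \<phi> (seq_prod A B)"
    using \<phi> by (auto simp: sequential_automorphism_def)
  have E_eq: "?E = \<phi> ` ?E" using bij by (simp add: bij_betw_def)
  have inj: "\<phi> A = \<phi> B \<longleftrightarrow> A = B" if "A \<in> ?E" "B \<in> ?E" for A B
    using bij that by (auto simp: bij_betw_def dest: inj_onD)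
  have "\<phi> A \<preceq> \<phi> B \<longleftrightarrow> (\<exists>C\<in>?E. \<phi> A = seq_prod (\<phi> B) C)"
    using A B E_eq by (intro op_le_iff_seq_prod[OF M]) auto
  also have "\<dots> \<longleftrightarrow> (\<exists>C\<in>\<phi> ` ?E. \<phi> A = seq_prod (\<phi> B) C)"
    using E_eq by simp
  also have "\<dots> \<longleftrightarrow> (\<exists>C\<in>?E. A = seq_prod B C)"
    using A B by (auto simp: seq inj seq_prod_in[OF M])
  also have "\<dots> \<longleftrightarrow> A \<preceq> B"
    using op_le_iff_seq_prod[OF M A B] by simp
  finally show ?thesis by simp
qed

lemma sequential_automorphism_zero_product:
  assumes M: "von_neumann_algebra M" and \<phi>: "sequential_automorphism M \<phi>"
    and A: "A \<in> effects_in M" and B: "B \<in> effects_in M"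
  shows "A o\<^sub>L B = 0 \<longleftrightarrow> \<phi> A o\<^sub>L \<phi> B = 0"
proof -
  let ?E = "effects_in M"
  have bij: "bij_betw \<phi> ?E ?E"
    and seq: "\<And>A B. A \<in> ?E \<Longrightarrow> B \<in> ?E \<Longrightarrow> seq_prod (\<phi> A) (\<phi> B) = \<phi> (seq_prod A B)"
    using \<phi> by (auto simp: sequential_automorphism_def)
  have \<phi>0: "\<phi> 0 = 0"
    using M bij by (rule bij_betw_zero_if_least) (use sequential_automorphism_order[OF M \<phi>] in blast)
  have eq_0: "\<phi> C = 0 \<longleftrightarrow> C = 0" if "C \<in> ?E" for C
    using bij \<phi>0 that effects_in_0[OF M] unfolding bij_betw_def by (metis inj_onD)
  have eff: "A \<in> effects" "B \<in> effects" "\<phi> A \<in> effects" "\<phi> B \<in> effects"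
    using A B bij by (auto simp: effects_in_def bij_betw_def)
  have "\<phi> A o\<^sub>L \<phi> B = 0 \<longleftrightarrow> seq_prod (\<phi> A) (\<phi> B) = 0"
    using eff by (simp add: seq_prod_eq_0_iff)
  also have "\<dots> \<longleftrightarrow> seq_prod A B = 0"
    by (simp add: seq A B eq_0 seq_prod_in[OF M])
  also have "\<dots> \<longleftrightarrow> A o\<^sub>L B = 0"
    using eff by (simp add: seq_prod_eq_0_iff)
  finally show ?thesis by simp
qed

theorem mainTheorem8:
  fixes M :: "('h::complex_hilbert_space \<Rightarrow>\<^sub>L 'h) set"
    and \<phi> :: "('h \<Rightarrow>\<^sub>L 'h) \<Rightarrow> ('h \<Rightarrow>\<^sub>L 'h)"
  assumes dim_ge_2: "\<exists>B :: 'h set. orthonormal_basis B \<and> (infinite B \<or> card B \<ge> 2)"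
    and vN: "von_neumann_algebra M"
    and aut: "ortho_order_automorphism M \<phi> \<or> sequential_automorphism M \<phi>"
  shows "\<forall>A\<in>effects_in M. \<forall>B\<in>effects_in M.
           (A \<preceq> B \<longleftrightarrow> \<phi> A \<preceq> \<phi> B) \<and>
           (A o\<^sub>L B = 0 \<longleftrightarrow> \<phi> A o\<^sub>L \<phi> B = 0)"
  using aut
proof
  assume "ortho_order_automorphism M \<phi>"
  then show ?thesis
    using ortho_order_automorphism_zero_product[OF vN]
    by (auto simp: ortho_order_automorphism_def)
next
  assume "sequential_automorphism M \<phi>"
  then show ?thesis
    using sequential_automorphism_order[OF vN] sequential_automorphism_zero_product[OF vN] by blast
qed

end
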